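(* Let $X$ and $Y$ be two standard Borel measurable spaces. Let $T:X\to X$ and $S:Y\to Y$ be invertible, bi-measurable transformations. Let $\sigma$ be a $\sigma$-finite measure on $X\times Y$ satisfying: (i) there exist measurable $X_0\subset X$ and $Y_0\subset Y$ with $0<\sigma(X_0\times Y_0)<\infty$; (ii) $\sigma$ is $T\times S$-invariant; (iii) the dynamical system $(X\times Y,T\times S,\sigma)$ is conservative and ergodic; (iv) $\mathrm{Id}\times S$ is non-singular with respect to $\sigma$. Then $\sigma$ is in fact $\mathrm{Id}\times S$-invariant, and there exist two measures $\mu$ and $\nu$, respectively on $X$ and $Y$, invariant by $T$ and $S$ respectively, such that $\sigma=\mu\otimes\nu$. Moreover, the dynamical systems $(X,\mu,T)$ and $(Y,\nu,S)$ are conservative and ergodic.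
   Context: Here $(T\times S)(x,y)=(Tx,Sy)$ and $(\mathrm{Id}\times S)(x,y)=(x,Sy)$. Non-singular means that the pushforward $(\mathrm{Id}\times S)_*\sigma$ is equivalent to $\sigma$ (same null sets). Conservative means that there is no wandering set of positive measure. *)

theory Defs
  imports "HOL-Analysis.Analysis"
begin

text \<open>Only the underlying measurable space of \<open>M\<close> matters here: its \<open>\<sigma>\<close>-algebra is the
  Borel \<open>\<sigma>\<close>-algebra of some Polish topology on its carrier.\<close>

definition standard_borel :: "'a measure \<Rightarrow> bool" where
  "standard_borel M \<longleftrightarrow>
     (\<exists>\<tau>. topspace \<tau> = space M \<and> completely_metrizable_space \<tau> \<and> second_countable \<tau> \<and>
          sets M = sigma_sets (space M) {U. openin \<tau> U})"

definition bimeasurable_bij :: "'a measure \<Rightarrow> ('a \<Rightarrow> 'a) \<Rightarrow> bool" where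
  "bimeasurable_bij M T \<longleftrightarrow>
     bij_betw T (space M) (space M) \<and> T \<in> M \<rightarrow>\<^sub>M M \<and> the_inv_into (space M) T \<in> M \<rightarrow>\<^sub>M M"

definition invariant_under :: "'a measure \<Rightarrow> ('a \<Rightarrow> 'a) \<Rightarrow> bool" where
  "invariant_under M T \<longleftrightarrow> T \<in> M \<rightarrow>\<^sub>M M \<and> distr M M T = M"

definition nonsingular :: "'a measure \<Rightarrow> ('a \<Rightarrow> 'a) \<Rightarrow> bool" where
  "nonsingular M T \<longleftrightarrow> T \<in> M \<rightarrow>\<^sub>M M \<and> null_sets (distr M M T) = null_sets M"

text \<open>A set is wandering if its iterated preimages are pairwise disjoint. For invertible \<open>T\<close>
  this is the same as disjointness of all images under \<open>T\<^sup>n\<close> with \<open>n\<close> an integer.\<close>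

definition wandering :: "'a measure \<Rightarrow> ('a \<Rightarrow> 'a) \<Rightarrow> 'a set \<Rightarrow> bool" where
  "wandering M T W \<longleftrightarrow>
     W \<in> sets M \<and> disjoint_family (\<lambda>n::nat. (T ^^ n) -` W \<inter> space M)"

definition conservative :: "'a measure \<Rightarrow> ('a \<Rightarrow> 'a) \<Rightarrow> bool" where
  "conservative M T \<longleftrightarrow> \<not> (\<exists>W. wandering M T W \<and> emeasure M W > 0)"

definition ergodic :: "'a measure \<Rightarrow> ('a \<Rightarrow> 'a) \<Rightarrow> bool" where
  "ergodic M T \<longleftrightarrow>
     (\<forall>A\<in>sets M. T -` A \<inter> space M = A \<longrightarrow> emeasure M A = 0 \<or> emeasure M (space M - A) = 0)"

end

theory Submission
  imports Defs
begin

text \<open>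
  The single tool is uniqueness of invariant measures: a \<open>\<sigma>\<close>-finite invariant measure that is
  absolutely continuous with respect to an ergodic one is a constant multiple of it
  (\<open>ergodic_invariant_measure_unique\<close>). It is used twice.

  First, \<open>Id \<times> S\<close> commutes with \<open>T \<times> S\<close>, so the image of \<open>\<sigma>\<close> under \<open>Id \<times> S\<close> is \<open>T \<times> S\<close>-invariant, and by
  non-singularity it equals \<open>c \<sigma>\<close> for a constant \<open>c\<close>. If \<open>c \<noteq> 1\<close>, then either the sets \<open>X0 \<times> S\<^sup>-\<^sup>n Y0\<close> or
  the sets \<open>T\<^sup>-\<^sup>n X0 \<times> Y0\<close> have geometrically decaying measure, and Borel--Cantelli forbids the
  infinitely many returns to \<open>X0 \<times> Y0\<close> that conservativity guarantees. Hence \<open>c = 1\<close>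
  (\<open>second_factor_invariant\<close>), and \<open>\<sigma>\<close> is invariant under \<open>Id \<times> S\<close> and under \<open>T \<times> Id\<close>.

  Second, for measurable \<open>A\<close> the section \<open>B \<mapsto> \<sigma> (A \<times> B)\<close> is now \<open>S\<close>-invariant. A strictly
  \<open>S\<close>-invariant set \<open>B\<close> gives the \<open>T \<times> S\<close>-invariant set \<open>X \<times> B\<close>, so the section over \<open>X0\<close> is ergodic
  for \<open>S\<close>. Therefore, when \<open>\<sigma> (A \<times> Y0)\<close> is finite, the section over \<open>A\<close> is a multiple of the section
  over \<open>X0\<close>, and the multiple, as a function of \<open>A\<close>, is the measure \<open>\<mu>\<close> (\<open>sections_proportional\<close>). Thus
  \<open>\<sigma> (A \<times> B) = \<mu> A \<cdot> \<nu> B\<close>. Conservativity and ergodicity pass to both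
  coordinates because wandering and invariant sets pull back under the projections.
\<close>

section \<open>Recurrence and ergodic alternatives\<close>

lemma map_prod_funpow:
  fixes f :: "'a \<Rightarrow> 'a" and g :: "'b \<Rightarrow> 'b"
  shows "map_prod f g ^^ n = map_prod (f ^^ n) (g ^^ n)"
  by (induction n) (auto simp: fun_eq_iff)

lemma invariant_under_funpow:
  assumes "invariant_under M R"
  shows "invariant_under M (R ^^ n)"
proof (induction n)
  case 0
  then show ?case by (simp add: invariant_under_def id_def distr_id2)
next
  case (Suc n)
  have [measurable]: "R \<in> M \<rightarrow>\<^sub>M M" "R ^^ n \<in> M \<rightarrow>\<^sub>M M"
    using assms Suc by (auto simp: invariant_under_def)
  have "distr M M (R ^^ Suc n) = distr (distr M M (R ^^ n)) M R"
    by (simp add: distr_distr comp_def)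
  also have "\<dots> = M"
    using assms Suc by (simp add: invariant_under_def)
  finally show ?case
    by (simp add: invariant_under_def del: funpow.simps)
qed

lemma emeasure_vimage_invariant:
  assumes "invariant_under M R" "A \<in> sets M"
  shows "emeasure M ((R ^^ n) -` A \<inter> space M) = emeasure M A"
  using invariant_under_funpow[OF assms(1), of n] assms(2)
  by (metis emeasure_distr invariant_under_def)

lemma AE_invariant_funpow:
  assumes "invariant_under M R" "AE x in M. P x"
  shows "AE x in M. P ((R ^^ n) x)"
  using invariant_under_funpow[OF assms(1), of n] assms(2)
  by (metis AE_distrD invariant_under_def)

text \<open>Poincare recurrence. The points of \<open>A\<close> that never come back to \<open>A\<close> form a wandering set, hence
  a null set; a point of \<open>A\<close> with finitely many returns lands in that set at its last visit.\<close>

lemma conservative_recurrence: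
  assumes inv: "invariant_under M R" and cons: "conservative M R" and A: "A \<in> sets M"
  shows "AE x in M. x \<in> A \<longrightarrow> (\<exists>\<^sub>\<infinity>n. (R ^^ n) x \<in> A)"
proof -
  have R[measurable]: "R \<in> M \<rightarrow>\<^sub>M M" using inv by (simp add: invariant_under_def)
  note A[measurable]
  define W where "W = {x \<in> space M. x \<in> A \<and> (\<forall>n. (R ^^ Suc n) x \<notin> A)}"
  have W: "W \<in> sets M" unfolding W_def by measurable
  have no: False if "m < n" "(R ^^ m) x \<in> W" "(R ^^ n) x \<in> W" for m n x
  proof -
    obtain k where "n = Suc k + m" using less_imp_Suc_add[OF \<open>m < n\<close>] by auto
    then have "(R ^^ n) x = (R ^^ Suc k) ((R ^^ m) x)"
      by (simp only: funpow_add comp_apply)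
    moreover have "(R ^^ Suc k) ((R ^^ m) x) \<notin> A" "(R ^^ n) x \<in> A"
      using that(2,3) unfolding W_def by blast+
    ultimately show False by (simp only:)
  qed
  have "disjoint_family (\<lambda>n. (R ^^ n) -` W \<inter> space M)"
    unfolding disjoint_family_on_def
  proof (intro ballI impI)
    fix m n :: nat
    assume "m \<noteq> n"
    then show "((R ^^ m) -` W \<inter> space M) \<inter> ((R ^^ n) -` W \<inter> space M) = {}"
      using no[of m n] no[of n m] by (cases m n rule: linorder_cases) auto
  qed
  then have "emeasure M W = 0"
    using cons W unfolding conservative_def wandering_def by (metis not_gr_zero)
  then have "AE x in M. x \<notin> W" using W by (intro AE_not_in) (auto simp: null_sets_def)
  then have "AE x in M. \<forall>n. (R ^^ n) x \<notin> W"
    by (intro AE_all_countable[THEN iffD2] allI AE_invariant_funpow[OF inv])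
  then show ?thesis
  proof (rule AE_mp, intro AE_I2 impI)
    fix x assume x: "x \<in> space M" and nW: "\<forall>n. (R ^^ n) x \<notin> W" and xA: "x \<in> A"
    show "\<exists>\<^sub>\<infinity>n. (R ^^ n) x \<in> A"
    proof (rule ccontr)
      assume "\<not> (\<exists>\<^sub>\<infinity>n. (R ^^ n) x \<in> A)"
      then have fin: "finite {n. (R ^^ n) x \<in> A}" by (simp add: INFM_iff_infinite)
      define m where "m = Max {n. (R ^^ n) x \<in> A}"
      have "{n. (R ^^ n) x \<in> A} \<noteq> {}" using xA by (auto intro: exI[of _ 0])
      then have m: "(R ^^ m) x \<in> A" using Max_in[OF fin] by (auto simp: m_def)
      have later: "(R ^^ k) x \<notin> A" if "k > m" for k
        using Max_ge[OF fin, of k] that by (auto simp: m_def)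
      have "(R ^^ Suc n) ((R ^^ m) x) \<notin> A" for n
        using later[of "Suc n + m"] unfolding funpow_add comp_apply by simp
      moreover have "(R ^^ m) x \<in> space M"
        using measurable_space[OF measurable_compose_n[OF R] x] .
      ultimately have "(R ^^ m) x \<in> W" using m unfolding W_def by blast
      then show False using nW by auto
    qed
  qed
qed

text \<open>The predicate \<open>ergodic\<close> speaks only of strictly invariant sets. The set of points that visit
  \<open>A\<close> infinitely often is strictly invariant whatever \<open>A\<close> is, so it is the device through which
  ergodicity is applied to sets that are invariant only up to null sets.\<close>

lemma ergodic_infinitely_often:
  assumes R: "R \<in> M \<rightarrow>\<^sub>M M" and erg: "ergodic M R" and A: "A \<in> sets M"
  shows "(AE x in M. \<exists>\<^sub>\<infinity>n. (R ^^ n) x \<in> A) \<or> (AE x in M. \<not> (\<exists>\<^sub>\<infinity>n. (R ^^ n) x \<in> A))"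
proof -
  note R[measurable] A[measurable]
  define E where "E = {x \<in> space M. \<exists>\<^sub>\<infinity>n. (R ^^ n) x \<in> A}"
  have E[measurable]: "E \<in> sets M" unfolding E_def INFM_nat by measurable
  have shift: "(\<exists>\<^sub>\<infinity>n. (R ^^ n) (R x) \<in> A) \<longleftrightarrow> (\<exists>\<^sub>\<infinity>n. (R ^^ n) x \<in> A)" for x
    using MOST_Suc_iff[of "\<lambda>n. (R ^^ n) x \<notin> A"]
    unfolding funpow_Suc_right comp_apply frequently_def by simp
  have "R -` E \<inter> space M = E"
    using measurable_space[OF R] by (auto simp: E_def shift)
  then have "emeasure M E = 0 \<or> emeasure M (space M - E) = 0"
    using erg E unfolding ergodic_def by blast
  then show ?thesis
  proof
    assume "emeasure M E = 0"
    then have "AE x in M. x \<notin> E" using E by (intro AE_not_in null_setsI)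
    then show ?thesis by (auto simp: E_def)
  next
    assume "emeasure M (space M - E) = 0"
    then have "AE x in M. x \<notin> space M - E" using E by (intro AE_not_in null_setsI) auto
    then show ?thesis by (auto simp: E_def)
  qed
qed

lemma ergodic_visits:
  assumes inv: "invariant_under M R" and cons: "conservative M R" and erg: "ergodic M R"
    and A: "A \<in> sets M" "emeasure M A > 0"
  shows "AE x in M. \<exists>\<^sub>\<infinity>n. (R ^^ n) x \<in> A"
proof (rule ccontr)
  assume "\<not> ?thesis"
  moreover have "R \<in> M \<rightarrow>\<^sub>M M" using inv by (simp add: invariant_under_def)
  ultimately have "AE x in M. \<not> (\<exists>\<^sub>\<infinity>n. (R ^^ n) x \<in> A)"
    using ergodic_infinitely_often[OF _ erg A(1)] by blast
  with conservative_recurrence[OF inv cons A(1)] have "AE x in M. x \<notin> A" by eventually_elim auto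
  then show False using A AE_iff_null_sets[OF A(1)] by auto
qed

lemma ergodic_AE_invariant:
  assumes inv: "invariant_under M R" and erg: "ergodic M R"
    and [measurable]: "Measurable.pred M P"
    and P: "AE x in M. P (R x) \<longleftrightarrow> P x"
  shows "(AE x in M. P x) \<or> (AE x in M. \<not> P x)"
proof -
  have R[measurable]: "R \<in> M \<rightarrow>\<^sub>M M" using inv by (simp add: invariant_under_def)
  have "AE x in M. \<forall>n. P ((R ^^ Suc n) x) \<longleftrightarrow> P ((R ^^ n) x)"
    using AE_invariant_funpow[OF inv P] by (auto intro!: AE_all_countable[THEN iffD2])
  then have const: "AE x in M. \<forall>n. P ((R ^^ n) x) \<longleftrightarrow> P x"
  proof eventually_elim
    case (elim x)
    then have "P ((R ^^ n) x) \<longleftrightarrow> P x" for n by (induction n) auto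
    then show ?case by auto
  qed
  have "AE x in M. (\<exists>\<^sub>\<infinity>n. (R ^^ n) x \<in> {x \<in> space M. P x}) \<longleftrightarrow> P x"
    using const
  proof (rule AE_mp, intro AE_I2 impI)
    fix x assume x: "x \<in> space M" "\<forall>n. P ((R ^^ n) x) \<longleftrightarrow> P x"
    have "(R ^^ n) x \<in> space M" for n
      using measurable_space[OF measurable_compose_n[OF R] x(1)] .
    then have "(R ^^ n) x \<in> {x \<in> space M. P x} \<longleftrightarrow> P x" for n using x by auto
    then show "(\<exists>\<^sub>\<infinity>n. (R ^^ n) x \<in> {x \<in> space M. P x}) \<longleftrightarrow> P x" by simp
  qed
  moreover have "{x \<in> space M. P x} \<in> sets M" by measurable
  note ergodic_infinitely_often[OF R erg this]
  ultimately show ?thesis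
  proof (elim disjE, goal_cases)
    case 1
    then have "AE x in M. P x" by eventually_elim blast
    then show ?case ..
  next
    case 2
    then have "AE x in M. \<not> P x" by eventually_elim blast
    then show ?case ..
  qed
qed

text \<open>All the sets \<open>R\<^sup>-\<^sup>n A\<close> have the same measure as \<open>A\<close>, and the visits make them cover almost the
  whole space.\<close>

lemma sigma_finite_of_visits:
  assumes inv: "invariant_under M R" and A: "A \<in> sets M" "emeasure M A < \<infinity>"
    and vis: "AE x in M. \<exists>n. (R ^^ n) x \<in> A"
  shows "sigma_finite_measure M"
proof
  have R[measurable]: "R \<in> M \<rightarrow>\<^sub>M M" using inv by (simp add: invariant_under_def)
  note A(1)[measurable]
  define N where "N = {x \<in> space M. \<forall>n. (R ^^ n) x \<notin> A}"
  have N: "N \<in> sets M" unfolding N_def by measurable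
  have "emeasure M N = 0"
    using vis N by (subst AE_iff_measurable[OF N, symmetric]) (auto simp: N_def)
  moreover have "(R ^^ n) -` A \<inter> space M \<in> sets M" for n by measurable
  moreover have "emeasure M ((R ^^ n) -` A \<inter> space M) \<noteq> \<infinity>" for n
    using emeasure_vimage_invariant[OF inv A(1)] A(2) by auto
  ultimately show "\<exists>F. countable F \<and> F \<subseteq> sets M \<and> \<Union>F = space M \<and> (\<forall>a\<in>F. emeasure M a \<noteq> \<infinity>)"
    using N sets.sets_into_space
    by (intro exI[of _ "insert N (range (\<lambda>n. (R ^^ n) -` A \<inter> space M))"]) (auto simp: N_def)
qed

section \<open>Uniqueness of the invariant measure\<close>

text \<open>The density \<open>f\<close> of \<open>N\<close> with respect to \<open>M\<close> satisfies \<open>f \<circ> R = f\<close> almost everywhere, by uniqueness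
  of densities: \<open>f\<close> and \<open>f \<circ> R\<close> are densities of measures with the same image under \<open>R\<close>, and the left
  inverse \<open>R'\<close> cancels \<open>R\<close>. By ergodicity each level set of \<open>f\<close> is null or conull, so \<open>f\<close> is
  almost everywhere constant.\<close>

lemma ergodic_invariant_measure_unique:
  assumes sf: "sigma_finite_measure M" and sfN: "sigma_finite_measure N"
    and inv: "invariant_under M R" and erg: "ergodic M R"
    and R': "R' \<in> M \<rightarrow>\<^sub>M M" "\<And>x. x \<in> space M \<Longrightarrow> R' (R x) = x"
    and setsN: "sets N = sets M" and invN: "invariant_under N R"
    and ac: "absolutely_continuous M N"
  obtains c where "c < \<infinity>" "\<And>A. A \<in> sets M \<Longrightarrow> emeasure N A = c * emeasure M A"
proof (cases "emeasure M (space M) = 0")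
  case True
  then have "A \<in> null_sets M" if "A \<in> sets M" for A
    using that emeasure_space[of M A] by (auto simp: null_sets_def)
  then have "emeasure N A = 0 * emeasure M A" if "A \<in> sets M" for A
    using ac that by (auto simp: absolutely_continuous_def)
  then show ?thesis using that[of 0] by auto
next
  case False
  interpret sigma_finite_measure M by fact
  have R[measurable]: "R \<in> M \<rightarrow>\<^sub>M M" using inv by (simp add: invariant_under_def)
  note R'(1)[measurable]
  define f where "f = RN_deriv M N"
  have f[measurable]: "f \<in> borel_measurable M" by (simp add: f_def)
  have N: "density M f = N" using density_RN_deriv[OF ac setsN] by (simp add: f_def)
  have undo: "distr (distr L M R) M R' = L"
    if L: "sets L = sets M" for L
  proof -
    have [measurable]: "R \<in> L \<rightarrow>\<^sub>M M" using L by (simp cong: measurable_cong_sets)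
    have "distr (distr L M R) M R' = distr L M (R' \<circ> R)"
      by (rule distr_distr) measurable
    also have "\<dots> = distr L M (\<lambda>x. x)"
      using R'(2) sets_eq_imp_space_eq[OF L] by (intro distr_cong) auto
    finally have "distr (distr L M R) M R' = distr L M (\<lambda>x. x)" .
    then show ?thesis using L by (simp add: distr_id2)
  qed
  have "distr N M R = N"
    using invN setsN unfolding invariant_under_def by (metis distr_cong)
  also have "N = density (distr M M R) f"
    using N inv by (simp add: invariant_under_def)
  also have "\<dots> = distr (density M (\<lambda>x. f (R x))) M R"
    by (rule density_distr) auto
  finally have push: "distr N M R = distr (density M (\<lambda>x. f (R x))) M R" .
  have "density M (\<lambda>x. f (R x)) = distr (distr (density M (\<lambda>x. f (R x))) M R) M R'"
    by (rule undo[symmetric]) simp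
  also have "\<dots> = N"
    unfolding push[symmetric] using setsN by (rule undo)
  finally have fR: "AE x in M. f (R x) = f x"
    unfolding f_def[symmetric] by (intro RN_deriv_unique[where N = N, folded f_def]) auto
  \<comment> \<open>A countable dense set of levels: then one null set serves for all of them, and almost every
    point can be taken as \<open>x0\<close>, the point where the constant value is read off.\<close>
  obtain D :: "ennreal set" where D: "countable D" "\<And>x y. x < y \<Longrightarrow> \<exists>d\<in>D. x < d \<and> d < y"
    using countable_separating_set_dense_linorder by metis
  have level: "(AE x in M. f x < d) \<or> (AE x in M. \<not> f x < d)" for d
  proof (rule ergodic_AE_invariant[OF inv erg])
    show "AE x in M. f (R x) < d \<longleftrightarrow> f x < d" using fR by eventually_elim simp
  qed measurable
  have "AE x in M. f x < d \<longleftrightarrow> (AE x in M. f x < d)" for d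
  proof (cases "AE x in M. f x < d")
    case True
    then show ?thesis by simp
  next
    case False
    then show ?thesis using level[of d] by simp
  qed
  then have lev: "AE x in M. \<forall>d\<in>D. f x < d \<longleftrightarrow> (AE x in M. f x < d)"
    using D(1) by (intro AE_ball_countable[THEN iffD2]) auto
  moreover have "AE x in M. f x \<noteq> \<infinity>"
    using RN_deriv_finite[OF sfN ac setsN] by (simp add: f_def)
  ultimately have "AE x in M. f x \<noteq> \<infinity> \<and> (\<forall>d\<in>D. f x < d \<longleftrightarrow> (AE x in M. f x < d))"
    by eventually_elim auto
  moreover have "ae_filter M \<noteq> bot"
    using False by (simp add: ae_filter_eq_bot_iff)
  ultimately obtain x0 where x0: "f x0 \<noteq> \<infinity>" "\<forall>d\<in>D. f x0 < d \<longleftrightarrow> (AE x in M. f x < d)"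
    using eventually_happens by blast
  have "AE x in M. f x = f x0"
    using lev
  proof eventually_elim
    case (elim x)
    show ?case
    proof (rule ccontr)
      assume "f x \<noteq> f x0"
      then consider "f x < f x0" | "f x0 < f x" by (meson linorder_neqE)
      then obtain d where "d \<in> D" "(f x < d) \<noteq> (f x0 < d)"
        by cases (use D(2) less_asym in blast)+
      then show False using elim x0(2) by blast
    qed
  qed
  then have "density M f = density M (\<lambda>_. f x0)" by (intro density_cong) auto
  then have "emeasure N A = f x0 * emeasure M A" if "A \<in> sets M" for A
    using N that by (metis emeasure_density_const)
  moreover have "f x0 < \<infinity>" using x0 by (simp add: less_top)
  ultimately show ?thesis using that by blast
qed

section \<open>Factors\<close>

lemma funpow_intertwine:
  assumes "\<And>z. z \<in> space M \<Longrightarrow> q (R z) = S (q z)" "R \<in> M \<rightarrow>\<^sub>M M" "z \<in> space M"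
  shows "q ((R ^^ n) z) = (S ^^ n) (q z)"
proof (induction n)
  case (Suc n)
  have "(R ^^ n) z \<in> space M"
    using measurable_space[OF measurable_compose_n[OF assms(2)] assms(3)] .
  then show ?case using Suc assms(1) by simp
qed simp

text \<open>The map \<open>q\<close> is a factor map up to the choice of the measure on the target: it is enough that the
  null sets of the image measure are null for \<open>N\<close>. Images of \<open>\<sigma>\<close> under the projections are in
  general not \<open>\<sigma>\<close>-finite, so \<open>N\<close> cannot be required to be the image measure itself.\<close>

lemma factor_conservative:
  assumes cons: "conservative M R" and R: "R \<in> M \<rightarrow>\<^sub>M M"
    and q: "q \<in> M \<rightarrow>\<^sub>M N" "\<And>z. z \<in> space M \<Longrightarrow> q (R z) = S (q z)"
    and null: "\<And>B. B \<in> sets N \<Longrightarrow> emeasure M (q -` B \<inter> space M) = 0 \<Longrightarrow> emeasure N B = 0"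
  shows "conservative N S"
  unfolding conservative_def
proof safe
  fix W assume W: "wandering N S W" and pos: "0 < emeasure N W"
  define V where "V = q -` W \<inter> space M"
  have V: "V \<in> sets M" using W q by (auto simp: V_def wandering_def)
  have "(R ^^ n) -` V \<inter> space M = q -` ((S ^^ n) -` W \<inter> space N) \<inter> space M" for n
    using funpow_intertwine[where q = q and R = R and S = S, OF q(2) R] measurable_space[OF measurable_compose_n[OF R]]
      measurable_space[OF q(1)] by (auto simp: V_def)
  moreover have "((S ^^ m) -` W \<inter> space N) \<inter> ((S ^^ n) -` W \<inter> space N) = {}" if "m \<noteq> n" for m n
    using W that unfolding wandering_def disjoint_family_on_def by blast
  ultimately have "((R ^^ m) -` V \<inter> space M) \<inter> ((R ^^ n) -` V \<inter> space M) = {}" if "m \<noteq> n" for m n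
    using that by blast
  then have "wandering M R V"
    using V by (simp add: wandering_def disjoint_family_on_def)
  then have "emeasure M V = 0" using cons unfolding conservative_def by auto
  then show False using null[of W] W pos by (auto simp: V_def wandering_def)
qed

lemma factor_ergodic:
  assumes erg: "ergodic M R" and R: "R \<in> M \<rightarrow>\<^sub>M M"
    and q: "q \<in> M \<rightarrow>\<^sub>M N" "\<And>z. z \<in> space M \<Longrightarrow> q (R z) = S (q z)"
    and null: "\<And>B. B \<in> sets N \<Longrightarrow> emeasure M (q -` B \<inter> space M) = 0 \<Longrightarrow> emeasure N B = 0"
  shows "ergodic N S"
  unfolding ergodic_def
proof (intro ballI impI)
  fix B assume B: "B \<in> sets N" and SB: "S -` B \<inter> space N = B"
  define E where "E = q -` B \<inter> space M"
  have E: "E \<in> sets M" using B q by (auto simp: E_def)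
  have "R -` E \<inter> space M = q -` (S -` B \<inter> space N) \<inter> space M"
    using q(2) measurable_space[OF R] measurable_space[OF q(1)] by (auto simp: E_def)
  then have "R -` E \<inter> space M = E" by (simp add: SB E_def)
  then have "emeasure M E = 0 \<or> emeasure M (space M - E) = 0"
    using erg E by (auto simp: ergodic_def)
  moreover have "space M - E = q -` (space N - B) \<inter> space M"
    using measurable_space[OF q(1)] by (auto simp: E_def)
  ultimately show "emeasure N B = 0 \<or> emeasure N (space N - B) = 0"
    using null[OF B] null[of "space N - B"] B by (auto simp: E_def)
qed

section \<open>Systems on a product\<close>

text \<open>The sections \<open>B \<mapsto> \<sigma> (A \<times> B)\<close> and \<open>A \<mapsto> \<sigma> (A \<times> B)\<close> of a measure on a product are the
  cases \<open>q = snd\<close> and \<open>q = fst\<close>; restricting to \<open>E\<close> before projecting is what can make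
  them \<open>\<sigma>\<close>-finite.\<close>

definition marginal :: "'a measure \<Rightarrow> 'b measure \<Rightarrow> ('a \<Rightarrow> 'b) \<Rightarrow> 'a set \<Rightarrow> 'b measure" where
  "marginal M N q E = distr (restrict_space M E) N q"

lemma sets_marginal [simp]: "sets (marginal M N q E) = sets N"
  and space_marginal [simp]: "space (marginal M N q E) = space N"
  by (simp_all add: marginal_def)

lemma emeasure_marginal:
  assumes "q \<in> M \<rightarrow>\<^sub>M N" "E \<in> sets M" "B \<in> sets N"
  shows "emeasure (marginal M N q E) B = emeasure M (E \<inter> q -` B)"
proof -
  have "E \<subseteq> space M" using assms(2) by (rule sets.sets_into_space)
  moreover have "q \<in> restrict_space M E \<rightarrow>\<^sub>M N"
    using assms(1) by (rule measurable_restrict_space1)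
  ultimately show ?thesis
    using assms by (simp add: marginal_def emeasure_distr emeasure_restrict_space
        space_restrict_space Int_absorb2 Int_commute)
qed

lemma geometric_borel_cantelli:
  fixes r a :: ennreal
  assumes E: "\<And>n. E n \<in> sets M" "\<And>n. emeasure M (E n) = r ^ n * a" and "r < 1" "a < \<infinity>"
  shows "AE x in M. \<not> (\<exists>\<^sub>\<infinity>n. x \<in> E n)"
proof -
  have fin: "r ^ n * a < \<infinity>" for n
    using assms(3,4) by (auto simp: ennreal_mult_less_top power_less_top_ennreal less_top
        intro: order.strict_trans)
  have "enn2real r < 1"
    using \<open>r < 1\<close> by (cases r) (auto simp: ennreal_less_one_iff)
  then have "summable (\<lambda>n. enn2real r ^ n * enn2real a)"
    by (intro summable_mult2 summable_geometric) auto
  moreover have "enn2real (r ^ n) = enn2real r ^ n" for n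
    by (induction n) (simp_all add: enn2real_mult)
  then have "measure M (E n) = enn2real r ^ n * enn2real a" for n
    by (simp add: measure_def E(2) enn2real_mult)
  ultimately have "AE x in M. eventually (\<lambda>n. x \<in> space M - E n) sequentially"
    using E fin by (intro borel_cantelli_AE1) auto
  then show ?thesis
    by eventually_elim (auto simp: frequently_def cofinite_eq_sequentially elim: eventually_mono)
qed

locale product_system =
  fixes X :: "'a measure" and Y :: "'b measure"
    and T T' :: "'a \<Rightarrow> 'a" and S S' :: "'b \<Rightarrow> 'b"
    and \<sigma> :: "('a \<times> 'b) measure" and X0 :: "'a set" and Y0 :: "'b set"
  assumes T [measurable]: "T \<in> X \<rightarrow>\<^sub>M X" and T' [measurable]: "T' \<in> X \<rightarrow>\<^sub>M X"
    and S [measurable]: "S \<in> Y \<rightarrow>\<^sub>M Y" and S' [measurable]: "S' \<in> Y \<rightarrow>\<^sub>M Y"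
    and T'T: "\<And>x. x \<in> space X \<Longrightarrow> T' (T x) = x"
    and S'S: "\<And>y. y \<in> space Y \<Longrightarrow> S' (S y) = y"
    and sets_\<sigma> [measurable_cong]: "sets \<sigma> = sets (X \<Otimes>\<^sub>M Y)"
    and sf: "sigma_finite_measure \<sigma>"
    and X0 [measurable]: "X0 \<in> sets X" and Y0 [measurable]: "Y0 \<in> sets Y"
    and pos: "0 < emeasure \<sigma> (X0 \<times> Y0)" and fin: "emeasure \<sigma> (X0 \<times> Y0) < \<infinity>"
    and inv: "invariant_under \<sigma> (map_prod T S)"
    and cons: "conservative \<sigma> (map_prod T S)" and erg: "ergodic \<sigma> (map_prod T S)"
    and nonsing: "nonsingular \<sigma> (map_prod id S)"
begin

lemma space_\<sigma>: "space \<sigma> = space X \<times> space Y"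
  using sets_eq_imp_space_eq[OF sets_\<sigma>] by (simp add: space_pair_measure)

lemma rect [measurable, intro]: "A \<in> sets X \<Longrightarrow> B \<in> sets Y \<Longrightarrow> A \<times> B \<in> sets \<sigma>"
  by (simp add: sets_\<sigma>)

lemma measurable_map_prod [measurable (raw)]:
  assumes [measurable]: "f \<in> X \<rightarrow>\<^sub>M X" "g \<in> Y \<rightarrow>\<^sub>M Y"
  shows "map_prod f g \<in> \<sigma> \<rightarrow>\<^sub>M \<sigma>"
proof -
  have "(\<lambda>z. (f (fst z), g (snd z))) \<in> \<sigma> \<rightarrow>\<^sub>M \<sigma>" by measurable
  then show ?thesis by (simp add: map_prod_def case_prod_unfold)
qed

lemma measurable_projections [measurable]: "fst \<in> \<sigma> \<rightarrow>\<^sub>M X" "snd \<in> \<sigma> \<rightarrow>\<^sub>M Y"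
  by measurable

lemma AE_visits_rect: "AE z in \<sigma>. \<exists>\<^sub>\<infinity>n. (map_prod T S ^^ n) z \<in> X0 \<times> Y0"
  using inv cons erg pos by (intro ergodic_visits) auto

lemma emeasure_vimage_rect:
  assumes "A \<in> sets X" "B \<in> sets Y"
  shows "emeasure \<sigma> ((T -` A \<inter> space X) \<times> (S -` B \<inter> space Y)) = emeasure \<sigma> (A \<times> B)"
proof -
  have "map_prod T S -` (A \<times> B) \<inter> space \<sigma> = (T -` A \<inter> space X) \<times> (S -` B \<inter> space Y)"
    by (auto simp: space_\<sigma>)
  then show ?thesis
    using emeasure_vimage_invariant[OF inv rect[OF assms], of 1] by (simp add: comp_def id_def)
qed

text \<open>The measure \<open>(Id \<times> S)\<^sub>* \<sigma>\<close> is again \<open>T \<times> S\<close>-invariant because the two maps commute, and it is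
  absolutely continuous by non-singularity. So uniqueness of the invariant measure applies, once
  \<open>\<sigma>\<close>-finiteness is known; for this the rectangle \<open>W\<close> is chosen such that its preimage is
  \<open>X0 \<times> Y0\<close>.\<close>

lemma second_factor_scales:
  obtains c where "0 < c" "c < \<infinity>"
    "\<And>E. E \<in> sets \<sigma> \<Longrightarrow> emeasure (distr \<sigma> \<sigma> (map_prod id S)) E = c * emeasure \<sigma> E"
proof -
  define N where "N = distr \<sigma> \<sigma> (map_prod id S)"
  define W where "W = X0 \<times> (S' -` Y0 \<inter> space Y)"
  have [measurable]: "map_prod id S \<in> \<sigma> \<rightarrow>\<^sub>M \<sigma>" "map_prod T S \<in> \<sigma> \<rightarrow>\<^sub>M \<sigma>"
    by measurable
  have W: "W \<in> sets \<sigma>" unfolding W_def by auto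
  have null: "null_sets N = null_sets \<sigma>" using nonsing by (simp add: nonsingular_def N_def)
  have "map_prod id S -` W \<inter> space \<sigma> = X0 \<times> Y0"
    using sets.sets_into_space[OF X0] sets.sets_into_space[OF Y0] measurable_space[OF S]
    by (auto simp: W_def space_\<sigma> S'S)
  then have NW: "emeasure N W = emeasure \<sigma> (X0 \<times> Y0)"
    using W by (simp add: N_def emeasure_distr)
  then have "W \<notin> null_sets N" using pos by auto
  then have "W \<notin> null_sets \<sigma>" by (simp only: null not_False_eq_True)
  then have "emeasure \<sigma> W > 0" using W by (auto simp: null_sets_def zero_less_iff_neq_zero)
  then have "AE z in \<sigma>. \<exists>\<^sub>\<infinity>n. (map_prod T S ^^ n) z \<in> W"
    using inv cons erg W by (intro ergodic_visits)
  then have "AE z in \<sigma>. \<exists>n. (map_prod T S ^^ n) z \<in> W"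
    by eventually_elim (auto dest: INFM_EX)
  then have vis: "AE z in N. \<exists>n. (map_prod T S ^^ n) z \<in> W"
    unfolding eventually_ae_filter null by (simp add: N_def)
  have "distr N N (map_prod T S) = distr \<sigma> \<sigma> (map_prod T S \<circ> map_prod id S)"
    unfolding N_def by (subst distr_distr) (auto intro!: distr_cong)
  also have "map_prod T S \<circ> map_prod id S = map_prod id S \<circ> map_prod T S"
    by (auto simp: fun_eq_iff)
  also have "distr \<sigma> \<sigma> \<dots> = distr (distr \<sigma> \<sigma> (map_prod T S)) \<sigma> (map_prod id S)"
    by (subst distr_distr) auto
  also have "\<dots> = N" using inv by (simp add: N_def invariant_under_def)
  finally have invN: "invariant_under N (map_prod T S)"
    by (simp add: invariant_under_def N_def)
  have sfN: "sigma_finite_measure N"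
    using vis W NW fin by (intro sigma_finite_of_visits[OF invN, of W]) (auto simp: N_def)
  obtain c where c: "c < \<infinity>" "\<And>E. E \<in> sets \<sigma> \<Longrightarrow> emeasure N E = c * emeasure \<sigma> E"
  proof (rule ergodic_invariant_measure_unique[OF sf sfN inv erg, of "map_prod T' S'"])
    show "map_prod T' S' \<in> \<sigma> \<rightarrow>\<^sub>M \<sigma>" by measurable
  qed (use invN null in \<open>auto simp: N_def space_\<sigma> T'T S'S absolutely_continuous_def\<close>)
  have "c \<noteq> 0" using c(2)[OF W] NW pos by auto
  then show ?thesis using c that by (auto simp: N_def zero_less_iff_neq_zero)
qed

text \<open>The heart of the argument: the scaling constant \<open>c\<close> is \<open>1\<close>. Since \<open>\<sigma> (X0 \<times> S\<^sup>-\<^sup>n Y0) = c\<^sup>n \<sigma> (X0 \<times> Y0)\<close>,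
  for \<open>c < 1\<close> the Borel--Cantelli lemma says that almost every point of \<open>X0 \<times> Y0\<close> has its second
  coordinate in \<open>Y0\<close> only finitely often, contradicting recurrence of \<open>T \<times> S\<close>. Because \<open>T \<times> S\<close> preserves
  \<open>\<sigma>\<close>, the first coordinate scales by \<open>1 / c\<close>, which rules out \<open>c > 1\<close> in the same way.\<close>

lemma second_factor_invariant: "distr \<sigma> \<sigma> (map_prod id S) = \<sigma>"
proof -
  obtain c where c: "0 < c" "c < \<infinity>"
    and scale: "\<And>E. E \<in> sets \<sigma> \<Longrightarrow> emeasure (distr \<sigma> \<sigma> (map_prod id S)) E = c * emeasure \<sigma> E"
    using second_factor_scales by blast
  have scaleS: "emeasure \<sigma> (A \<times> (S -` B \<inter> space Y)) = c * emeasure \<sigma> (A \<times> B)"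
    if A: "A \<in> sets X" and B: "B \<in> sets Y" for A B
  proof -
    have "map_prod id S -` (A \<times> B) \<inter> space \<sigma> = A \<times> (S -` B \<inter> space Y)"
      using sets.sets_into_space[OF A] by (auto simp: space_\<sigma>)
    then show ?thesis using scale[OF rect[OF A B]] A B by (simp add: emeasure_distr)
  qed
  have scaleT: "emeasure \<sigma> ((T -` A \<inter> space X) \<times> B) = inverse c * emeasure \<sigma> (A \<times> B)"
    if A: "A \<in> sets X" and B: "B \<in> sets Y" for A B
  proof -
    \<comment> \<open>Writing \<open>B = S\<^sup>-\<^sup>1 B'\<close> trades \<open>T \<times> Id\<close> for \<open>T \<times> S\<close>, which preserves \<open>\<sigma>\<close>.\<close>
    define B' where "B' = S' -` B \<inter> space Y"
    have B': "B' \<in> sets Y" using B by (simp add: B'_def)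
    have SB': "S -` B' \<inter> space Y = B"
      using sets.sets_into_space[OF B] measurable_space[OF S] by (auto simp: B'_def S'S)
    have "emeasure \<sigma> ((T -` A \<inter> space X) \<times> B) = emeasure \<sigma> (A \<times> B')"
      using emeasure_vimage_rect[OF A B'] by (simp add: SB')
    also have "\<dots> = inverse c * (c * emeasure \<sigma> (A \<times> B'))"
      using c ennreal_divide_self[of c]
      by (simp add: mult.assoc[symmetric] divide_ennreal_def mult.commute[of "inverse c" c])
    finally show ?thesis using scaleS[OF A B'] by (simp add: SB')
  qed
  have escape: False
    if E: "\<And>n. E n \<in> sets \<sigma>" "\<And>n. emeasure \<sigma> (E n) = r ^ n * emeasure \<sigma> (X0 \<times> Y0)"
      and r: "r < 1"
      and ret: "\<And>n z. z \<in> X0 \<times> Y0 \<Longrightarrow> (map_prod T S ^^ n) z \<in> X0 \<times> Y0 \<Longrightarrow> z \<in> E n"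
    for r E
  proof -
    have "AE z in \<sigma>. \<not> (\<exists>\<^sub>\<infinity>n. z \<in> E n)"
      using E r fin by (rule geometric_borel_cantelli)
    with AE_visits_rect have "AE z in \<sigma>. z \<notin> X0 \<times> Y0"
    proof eventually_elim
      case (elim z)
      then show ?case using ret[of z] by (metis (no_types, lifting) INFM_mono)
    qed
    then show False using pos AE_iff_null_sets[OF rect[OF X0 Y0]] by auto
  qed
  have "\<not> c < 1"
  proof
    assume "c < 1"
    define E where "E n = X0 \<times> ((S ^^ n) -` Y0 \<inter> space Y)" for n
    have E: "E n \<in> sets \<sigma>" for n unfolding E_def by (intro rect) measurable
    have scaled: "emeasure \<sigma> (E n) = c ^ n * emeasure \<sigma> (X0 \<times> Y0)" for n
    proof (induction n)
      case 0
      then show ?case using sets.sets_into_space[OF Y0] by (simp add: E_def Int_absorb2)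
    next
      case (Suc n)
      have "(S ^^ Suc n) -` Y0 \<inter> space Y = S -` ((S ^^ n) -` Y0 \<inter> space Y) \<inter> space Y"
        using measurable_space[OF S] by (auto simp: funpow_swap1)
      then show ?case using Suc scaleS[OF X0, of "(S ^^ n) -` Y0 \<inter> space Y"]
        by (simp add: E_def mult.assoc)
    qed
    have "z \<in> E n" if "z \<in> X0 \<times> Y0" "(map_prod T S ^^ n) z \<in> X0 \<times> Y0" for n z
      using that sets.sets_into_space[OF Y0] by (auto simp: E_def map_prod_funpow)
    then show False by (rule escape[OF E scaled \<open>c < 1\<close>])
  qed
  moreover have "\<not> c > 1"
  proof
    assume "c > 1"
    then have r: "inverse c < 1"
      using c by (cases c) (auto simp: inverse_ennreal ennreal_less_one_iff field_simps)
    define E where "E n = ((T ^^ n) -` X0 \<inter> space X) \<times> Y0" for n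
    have E: "E n \<in> sets \<sigma>" for n unfolding E_def by (intro rect) measurable
    have scaled: "emeasure \<sigma> (E n) = inverse c ^ n * emeasure \<sigma> (X0 \<times> Y0)" for n
    proof (induction n)
      case 0
      then show ?case using sets.sets_into_space[OF X0] by (simp add: E_def Int_absorb2)
    next
      case (Suc n)
      have "(T ^^ Suc n) -` X0 \<inter> space X = T -` ((T ^^ n) -` X0 \<inter> space X) \<inter> space X"
        using measurable_space[OF T] by (auto simp: funpow_swap1)
      then show ?case using Suc scaleT[OF _ Y0, of "(T ^^ n) -` X0 \<inter> space X"]
        by (simp add: E_def mult.assoc)
    qed
    have "z \<in> E n" if "z \<in> X0 \<times> Y0" "(map_prod T S ^^ n) z \<in> X0 \<times> Y0" for n z
      using that sets.sets_into_space[OF X0] by (auto simp: E_def map_prod_funpow)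
    then show False by (rule escape[OF E scaled r])
  qed
  ultimately have "c = 1" by auto
  then show ?thesis using scale by (intro measure_eqI) auto
qed

lemma emeasure_vimage_snd:
  assumes A: "A \<in> sets X" and B: "B \<in> sets Y"
  shows "emeasure \<sigma> (A \<times> (S -` B \<inter> space Y)) = emeasure \<sigma> (A \<times> B)"
proof -
  have "map_prod id S -` (A \<times> B) \<inter> space \<sigma> = A \<times> (S -` B \<inter> space Y)"
    using sets.sets_into_space[OF A] by (auto simp: space_\<sigma>)
  moreover have "map_prod id S \<in> \<sigma> \<rightarrow>\<^sub>M \<sigma>" by measurable
  ultimately show ?thesis
    using second_factor_invariant rect[OF A B] by (metis emeasure_distr)
qed

lemma emeasure_vimage_fst:
  assumes A: "A \<in> sets X" and B: "B \<in> sets Y"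
  shows "emeasure \<sigma> ((T -` A \<inter> space X) \<times> B) = emeasure \<sigma> (A \<times> B)"
  using emeasure_vimage_snd[of "T -` A \<inter> space X" B] emeasure_vimage_rect[OF A B] A B by simp

lemma emeasure_section:
  assumes A: "A \<in> sets X" and B: "B \<in> sets Y"
  shows "emeasure (marginal \<sigma> Y snd (A \<times> space Y)) B = emeasure \<sigma> (A \<times> B)"
    and "emeasure (marginal \<sigma> X fst (space X \<times> B)) A = emeasure \<sigma> (A \<times> B)"
proof -
  have "(A \<times> space Y) \<inter> snd -` B = A \<times> B" "(space X \<times> B) \<inter> fst -` A = A \<times> B"
    using sets.sets_into_space[OF A] sets.sets_into_space[OF B] by auto
  then show "emeasure (marginal \<sigma> Y snd (A \<times> space Y)) B = emeasure \<sigma> (A \<times> B)"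
    and "emeasure (marginal \<sigma> X fst (space X \<times> B)) A = emeasure \<sigma> (A \<times> B)"
    using A B by (simp_all add: emeasure_marginal rect measurable_projections)
qed

lemma invariant_section:
  shows "A \<in> sets X \<Longrightarrow> invariant_under (marginal \<sigma> Y snd (A \<times> space Y)) S"
    and "B \<in> sets Y \<Longrightarrow> invariant_under (marginal \<sigma> X fst (space X \<times> B)) T"
proof -
  let ?\<nu> = "marginal \<sigma> Y snd (A \<times> space Y)" and ?\<mu> = "marginal \<sigma> X fst (space X \<times> B)"
  have S1: "S \<in> ?\<nu> \<rightarrow>\<^sub>M ?\<nu>" and T1: "T \<in> ?\<mu> \<rightarrow>\<^sub>M ?\<mu>"
    using S T by (simp_all cong: measurable_cong_sets)
  show "invariant_under ?\<nu> S" if "A \<in> sets X"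
    unfolding invariant_under_def using S1 that
    by (auto intro!: measure_eqI simp: emeasure_distr emeasure_section emeasure_vimage_snd)
  show "invariant_under ?\<mu> T" if "B \<in> sets Y"
    unfolding invariant_under_def using T1 that
    by (auto intro!: measure_eqI simp: emeasure_distr emeasure_section emeasure_vimage_fst)
qed

lemma AE_section_visits:
  shows "A \<in> sets X \<Longrightarrow> AE y in marginal \<sigma> Y snd (A \<times> space Y). \<exists>n. (S ^^ n) y \<in> Y0"
    and "B \<in> sets Y \<Longrightarrow> AE x in marginal \<sigma> X fst (space X \<times> B). \<exists>n. (T ^^ n) x \<in> X0"
proof -
  have vis: "AE z in \<sigma>. \<exists>n. (T ^^ n) (fst z) \<in> X0 \<and> (S ^^ n) (snd z) \<in> Y0"
    using AE_visits_rect
    by eventually_elim (auto simp: map_prod_funpow dest!: INFM_EX)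
  show "AE y in marginal \<sigma> Y snd (A \<times> space Y). \<exists>n. (S ^^ n) y \<in> Y0" if A: "A \<in> sets X"
    unfolding marginal_def
    using vis A by (subst AE_distr_iff)
      (auto simp: AE_restrict_space_iff rect measurable_restrict_space1 elim!: eventually_mono)
  show "AE x in marginal \<sigma> X fst (space X \<times> B). \<exists>n. (T ^^ n) x \<in> X0" if B: "B \<in> sets Y"
    unfolding marginal_def
    using vis B by (subst AE_distr_iff)
      (auto simp: AE_restrict_space_iff rect measurable_restrict_space1 elim!: eventually_mono)
qed

text \<open>If \<open>X0 \<times> B\<close> is null, so is each \<open>T\<^sup>-\<^sup>n X0 \<times> B\<close>, and these cover \<open>space X \<times> B\<close> up to a null set. This gives
  the absolute continuity of every section with respect to the one over \<open>X0\<close>.\<close>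

lemma null_section:
  assumes A: "A \<in> sets X" and B: "B \<in> sets Y" and null: "emeasure \<sigma> (X0 \<times> B) = 0"
  shows "emeasure \<sigma> (A \<times> B) = 0"
proof -
  let ?\<mu> = "marginal \<sigma> X fst (space X \<times> B)"
  have "X0 \<in> null_sets ?\<mu>"
    using null B by (simp add: null_sets_def emeasure_section)
  then have "AE x in ?\<mu>. x \<notin> X0" by (rule AE_not_in)
  then have "AE x in ?\<mu>. \<forall>n. (T ^^ n) x \<notin> X0"
    by (intro AE_all_countable[THEN iffD2] allI AE_invariant_funpow[OF invariant_section(2)[OF B]])
  with AE_section_visits(2)[OF B] have "AE x in ?\<mu>. x \<notin> A" by eventually_elim auto
  then show ?thesis using A B by (simp add: AE_iff_null_sets[symmetric] null_sets_def emeasure_section)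
qed

lemma sigma_finite_section:
  assumes "A \<in> sets X" "emeasure \<sigma> (A \<times> Y0) < \<infinity>"
  shows "sigma_finite_measure (marginal \<sigma> Y snd (A \<times> space Y))"
  using assms
  by (intro sigma_finite_of_visits[OF invariant_section(1), of _ Y0])
    (simp_all add: emeasure_section AE_section_visits)

lemma ergodic_conservative_section:
  assumes A: "A \<in> sets X" and B: "B \<in> sets Y"
  shows "conservative (marginal \<sigma> Y snd (A \<times> space Y)) S" "ergodic (marginal \<sigma> Y snd (A \<times> space Y)) S"
    "conservative (marginal \<sigma> X fst (space X \<times> B)) T" "ergodic (marginal \<sigma> X fst (space X \<times> B)) T"
proof -
  let ?\<nu> = "marginal \<sigma> Y snd (A \<times> space Y)" and ?\<mu> = "marginal \<sigma> X fst (space X \<times> B)"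
  have R: "map_prod T S \<in> \<sigma> \<rightarrow>\<^sub>M \<sigma>" by measurable
  have q: "snd \<in> \<sigma> \<rightarrow>\<^sub>M ?\<nu>" "fst \<in> \<sigma> \<rightarrow>\<^sub>M ?\<mu>"
    using measurable_projections by (simp_all cong: measurable_cong_sets)
  have le: "emeasure ?\<nu> D \<le> emeasure \<sigma> (snd -` D \<inter> space \<sigma>)" if "D \<in> sets Y" for D
    using that A sets.sets_into_space[OF A] sets.sets_into_space[OF that]
      measurable_sets[OF measurable_projections(2) that]
    by (auto simp: emeasure_section space_\<sigma> intro!: emeasure_mono)
  have le': "emeasure ?\<mu> D \<le> emeasure \<sigma> (fst -` D \<inter> space \<sigma>)" if "D \<in> sets X" for D
    using that B sets.sets_into_space[OF B] sets.sets_into_space[OF that]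
      measurable_sets[OF measurable_projections(1) that]
    by (auto simp: emeasure_section space_\<sigma> intro!: emeasure_mono)
  show "conservative ?\<nu> S" using le
    by (intro factor_conservative[OF cons R q(1)]) (auto, metis le_zero_eq)
  show "ergodic ?\<nu> S" using le
    by (intro factor_ergodic[OF erg R q(1)]) (auto, metis le_zero_eq)
  show "conservative ?\<mu> T" using le'
    by (intro factor_conservative[OF cons R q(2)]) (auto, metis le_zero_eq)
  show "ergodic ?\<mu> T" using le'
    by (intro factor_ergodic[OF erg R q(2)]) (auto, metis le_zero_eq)
qed

text \<open>The sections over \<open>A\<close> and over \<open>X0\<close> are both \<open>S\<close>-invariant, and the latter is ergodic, so they are
  proportional; evaluation at \<open>Y0\<close> identifies the constant. This is the product structure of \<open>\<sigma>\<close>.\<close>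

lemma sections_proportional:
  assumes A: "A \<in> sets X" and B: "B \<in> sets Y" and finA: "emeasure \<sigma> (A \<times> Y0) < \<infinity>"
  shows "emeasure \<sigma> (A \<times> B) = emeasure \<sigma> (A \<times> Y0) / emeasure \<sigma> (X0 \<times> Y0) * emeasure \<sigma> (X0 \<times> B)"
proof -
  let ?\<nu> = "\<lambda>A. marginal \<sigma> Y snd (A \<times> space Y)"
  have ac: "absolutely_continuous (?\<nu> X0) (?\<nu> A)"
    using A null_section[OF A]
    by (auto simp: absolutely_continuous_def null_sets_def emeasure_section)
  have "S' \<in> ?\<nu> X0 \<rightarrow>\<^sub>M ?\<nu> X0" using S' by (simp cong: measurable_cong_sets)
  then obtain c where c: "\<And>D. D \<in> sets Y \<Longrightarrow> emeasure (?\<nu> A) D = c * emeasure (?\<nu> X0) D"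
    using ergodic_invariant_measure_unique[OF sigma_finite_section[OF X0 fin]
        sigma_finite_section[OF A finA] invariant_section(1)[OF X0]
        ergodic_conservative_section(2)[OF X0 Y0], of S'] ac invariant_section(1)[OF A]
    by (metis sets_marginal space_marginal S'S)
  have cD: "emeasure \<sigma> (A \<times> D) = c * emeasure \<sigma> (X0 \<times> D)" if "D \<in> sets Y" for D
    using c[OF that] A that by (simp add: emeasure_section)
  have "emeasure \<sigma> (A \<times> Y0) / emeasure \<sigma> (X0 \<times> Y0) = c"
    using cD[OF Y0] pos fin by (simp add: ennreal_mult_divide_eq)
  then show ?thesis using cD[OF B] by simp
qed

text \<open>The section over \<open>Y0\<close> is normalised to give \<open>X0\<close> mass \<open>1\<close>, since the factor \<open>\<sigma> (X0 \<times> Y0)\<close> must enter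
  only once in the product.\<close>

definition first_marginal :: "'a measure" where
  "first_marginal =
     scale_measure (inverse (emeasure \<sigma> (X0 \<times> Y0))) (marginal \<sigma> X fst (space X \<times> Y0))"

definition second_marginal :: "'b measure" where
  "second_marginal = marginal \<sigma> Y snd (X0 \<times> space Y)"

lemma emeasure_first_marginal:
  "A \<in> sets X \<Longrightarrow> emeasure first_marginal A = emeasure \<sigma> (A \<times> Y0) / emeasure \<sigma> (X0 \<times> Y0)"
  by (simp add: first_marginal_def emeasure_section divide_ennreal_def mult.commute)

lemma finite_first_marginal_iff:
  "A \<in> sets X \<Longrightarrow> emeasure first_marginal A \<noteq> \<infinity> \<longleftrightarrow> emeasure \<sigma> (A \<times> Y0) < \<infinity>"
  using pos fin by (auto simp: emeasure_first_marginal divide_ennreal_def ennreal_mult_eq_top_iff less_top)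

lemma null_first_marginal_iff:
  "A \<in> sets X \<Longrightarrow>
    emeasure first_marginal A = 0 \<longleftrightarrow> emeasure (marginal \<sigma> X fst (space X \<times> Y0)) A = 0"
  using pos fin by (auto simp: emeasure_first_marginal emeasure_section divide_ennreal_def)

lemma sets_first_marginal [simp]: "sets first_marginal = sets X"
  and space_first_marginal [simp]: "space first_marginal = space X"
  by (simp_all add: first_marginal_def space_scale_measure)

lemma invariant_first_marginal: "invariant_under first_marginal T"
proof -
  have "T \<in> first_marginal \<rightarrow>\<^sub>M first_marginal" using T by (simp cong: measurable_cong_sets)
  then show ?thesis unfolding invariant_under_def
    by (auto intro!: measure_eqI simp: emeasure_distr emeasure_first_marginal emeasure_vimage_fst)
qed

lemma conservative_first_marginal: "conservative first_marginal T"
  using ergodic_conservative_section(3)[OF X0 Y0]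
  by (auto simp: conservative_def wandering_def zero_less_iff_neq_zero null_first_marginal_iff)

lemma ergodic_first_marginal: "ergodic first_marginal T"
  using ergodic_conservative_section(4)[OF X0 Y0]
  by (simp add: ergodic_def null_first_marginal_iff)

lemma sigma_finite_first_marginal: "sigma_finite_measure first_marginal"
proof (rule sigma_finite_of_visits[OF invariant_first_marginal, of X0])
  show "emeasure first_marginal X0 < \<infinity>"
    using finite_first_marginal_iff[OF X0] fin by (simp add: less_top)
  have "null_sets first_marginal = null_sets (marginal \<sigma> X fst (space X \<times> Y0))"
    by (auto simp: null_sets_def null_first_marginal_iff)
  then show "AE x in first_marginal. \<exists>n. (T ^^ n) x \<in> X0"
    using AE_section_visits(2)[OF Y0] unfolding eventually_ae_filter by simp
qed simp

text \<open>Proportionality of sections needs \<open>\<sigma> (A \<times> Y0)\<close> to be finite; a general \<open>A\<close> is cut into countably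
  many such pieces, which is possible because \<open>first_marginal\<close> is \<open>\<sigma>\<close>-finite.\<close>

lemma emeasure_rect:
  assumes A: "A \<in> sets X" and B: "B \<in> sets Y"
  shows "emeasure first_marginal A * emeasure second_marginal B = emeasure \<sigma> (A \<times> B)"
proof -
  interpret \<mu>: sigma_finite_measure first_marginal by (rule sigma_finite_first_marginal)
  obtain F :: "nat \<Rightarrow> 'a set" where F: "range F \<subseteq> sets first_marginal" "(\<Union>i. F i) = space first_marginal"
      "\<And>i. emeasure first_marginal (F i) \<noteq> \<infinity>" "disjoint_family F"
    using \<mu>.sigma_finite_disjoint by blast
  define G where "G i = A \<inter> F i" for i
  have G: "G i \<in> sets X" for i using F(1) A by (auto simp: G_def)
  have A_eq: "A = (\<Union>i. G i)" using F(2) sets.sets_into_space[OF A] by (auto simp: G_def)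
  have disj: "disjoint_family G" using F(4) by (auto simp: G_def disjoint_family_on_def)
  have "emeasure first_marginal (G i) \<le> emeasure first_marginal (F i)" for i
    using F(1) by (intro emeasure_mono) (auto simp: G_def)
  then have "emeasure first_marginal (G i) \<noteq> \<infinity>" for i
    using F(3)[of i] by (metis infinity_ennreal_def top.extremum_unique)
  then have finG: "emeasure \<sigma> (G i \<times> Y0) < \<infinity>" for i
    using finite_first_marginal_iff[OF G] by blast
  have piece: "emeasure \<sigma> (G i \<times> B) = emeasure first_marginal (G i) * emeasure second_marginal B" for i
    using sections_proportional[OF G B finG] G B
    by (simp add: emeasure_first_marginal second_marginal_def emeasure_section)
  have "A \<times> B = (\<Union>i. G i \<times> B)" using A_eq by auto
  then have "emeasure \<sigma> (A \<times> B) = (\<Sum>i. emeasure \<sigma> (G i \<times> B))"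
    using G B disj by (auto intro!: suminf_emeasure[symmetric] simp: disjoint_family_on_def) blast
  also have "\<dots> = (\<Sum>i. emeasure first_marginal (G i)) * emeasure second_marginal B"
    by (simp add: piece)
  also have "(\<Sum>i. emeasure first_marginal (G i)) = emeasure first_marginal A"
    unfolding A_eq using disj G by (intro suminf_emeasure) auto
  finally show ?thesis ..
qed

lemma product_decomposition: "first_marginal \<Otimes>\<^sub>M second_marginal = \<sigma>"
proof (rule pair_measure_eqI)
  show "sigma_finite_measure first_marginal" by (rule sigma_finite_first_marginal)
  show "sigma_finite_measure second_marginal"
    unfolding second_marginal_def using X0 fin by (rule sigma_finite_section)
  show "sets (first_marginal \<Otimes>\<^sub>M second_marginal) = sets \<sigma>"
    by (simp add: sets_\<sigma> second_marginal_def cong: sets_pair_measure_cong)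
qed (use emeasure_rect in \<open>simp add: second_marginal_def\<close>)

end

section \<open>Decomposition of the invariant measure\<close>

theorem theoremA1:
  fixes X :: "'a measure" and Y :: "'b measure"
    and T :: "'a \<Rightarrow> 'a" and S :: "'b \<Rightarrow> 'b"
    and \<sigma> :: "('a \<times> 'b) measure"
  assumes "standard_borel X" and "standard_borel Y"
    and "bimeasurable_bij X T" and "bimeasurable_bij Y S"
    and "sets \<sigma> = sets (X \<Otimes>\<^sub>M Y)" and "sigma_finite_measure \<sigma>"
    and "\<exists>X0\<in>sets X. \<exists>Y0\<in>sets Y. 0 < emeasure \<sigma> (X0 \<times> Y0) \<and> emeasure \<sigma> (X0 \<times> Y0) < \<infinity>"
    and "invariant_under \<sigma> (map_prod T S)"
    and "conservative \<sigma> (map_prod T S)" and "ergodic \<sigma> (map_prod T S)"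
    and "nonsingular \<sigma> (map_prod id S)"
  shows "invariant_under \<sigma> (map_prod id S) \<and>
    (\<exists>\<mu> \<nu>. sets \<mu> = sets X \<and> sets \<nu> = sets Y \<and>
       sigma_finite_measure \<mu> \<and> sigma_finite_measure \<nu> \<and>
       invariant_under \<mu> T \<and> invariant_under \<nu> S \<and>
       \<sigma> = \<mu> \<Otimes>\<^sub>M \<nu> \<and>
       conservative \<mu> T \<and> ergodic \<mu> T \<and>
       conservative \<nu> S \<and> ergodic \<nu> S)"
proof -
  define T' where "T' = the_inv_into (space X) T"
  define S' where "S' = the_inv_into (space Y) S"
  obtain X0 Y0 where XY: "X0 \<in> sets X" "Y0 \<in> sets Y"
    "0 < emeasure \<sigma> (X0 \<times> Y0)" "emeasure \<sigma> (X0 \<times> Y0) < \<infinity>"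
    using assms(7) by blast
  have T: "bij_betw T (space X) (space X)" and S: "bij_betw S (space Y) (space Y)"
    using assms(3,4) by (auto simp: bimeasurable_bij_def)
  interpret product_system X Y T T' S S' \<sigma> X0 Y0
  proof
    show "T \<in> X \<rightarrow>\<^sub>M X" "T' \<in> X \<rightarrow>\<^sub>M X" "S \<in> Y \<rightarrow>\<^sub>M Y" "S' \<in> Y \<rightarrow>\<^sub>M Y"
      using assms(3,4) by (auto simp: bimeasurable_bij_def T'_def S'_def)
    show "T' (T x) = x" if "x \<in> space X" for x
      using T that by (simp add: T'_def bij_betw_def the_inv_into_f_f)
    show "S' (S y) = y" if "y \<in> space Y" for y
      using S that by (simp add: S'_def bij_betw_def the_inv_into_f_f)
  qed (fact assms XY sigma_finite_measure.sigma_finite_countable[OF assms(6)])+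
  have "invariant_under \<sigma> (map_prod id S)"
    using second_factor_invariant nonsing by (simp add: invariant_under_def nonsingular_def)
  moreover have "\<exists>\<mu> \<nu>. sets \<mu> = sets X \<and> sets \<nu> = sets Y \<and>
       sigma_finite_measure \<mu> \<and> sigma_finite_measure \<nu> \<and>
       invariant_under \<mu> T \<and> invariant_under \<nu> S \<and>
       \<sigma> = \<mu> \<Otimes>\<^sub>M \<nu> \<and>
       conservative \<mu> T \<and> ergodic \<mu> T \<and>
       conservative \<nu> S \<and> ergodic \<nu> S"
  proof (intro exI conjI)
    show "sets first_marginal = sets X" "sigma_finite_measure first_marginal"
      "invariant_under first_marginal T" "conservative first_marginal T" "ergodic first_marginal T"
      by (rule sets_first_marginal sigma_finite_first_marginal invariant_first_marginal
          conservative_first_marginal ergodic_first_marginal)+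
    show "\<sigma> = first_marginal \<Otimes>\<^sub>M second_marginal"
      by (rule product_decomposition[symmetric])
    show "sets second_marginal = sets Y" by (simp add: second_marginal_def)
    show "sigma_finite_measure second_marginal"
      unfolding second_marginal_def using X0 fin by (rule sigma_finite_section)
    show "invariant_under second_marginal S"
      unfolding second_marginal_def using X0 by (rule invariant_section(1))
    show "conservative second_marginal S" "ergodic second_marginal S"
      unfolding second_marginal_def using X0 Y0 by (rule ergodic_conservative_section)+
  qed
  ultimately show ?thesis ..
qed

end
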